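(* Let $n \in \mathbb{N}$. (SCAD) Let $\lambda_i > 0$ and $\gamma_i > 2$ for $i \in [n]$, and define, for $\boldsymbol{x} \in \mathbb{R}^n$, $$\rho^{\mathrm{SCAD}}(\boldsymbol{x}, \boldsymbol{\lambda}, \boldsymbol{\gamma}) = \sum_{i=1}^n \rho^{\mathrm{SCAD}}_i(x_i,\lambda_i,\gamma_i), \qquad \rho^{\mathrm{SCAD}}_i(x_i, \lambda_i, \gamma_i) = \lambda_i \int_{0}^{|x_i|} \min\left\{1, \frac{(\gamma_i - y/\lambda_i)_+}{\gamma_i - 1}\right\} dy .$$ Then $\boldsymbol{x} \mapsto \rho^{\mathrm{SCAD}}(\boldsymbol{x}, \boldsymbol{\lambda}, \boldsymbol{\gamma})$ is a scale function (with univariate components $x_i \mapsto \rho^{\mathrm{SCAD}}_i(x_i,\lambda_i,\gamma_i)$). (MCP) Let $\lambda_i > 0$ and $\gamma_i > 0$ for $i \in [n]$, and define, for $\boldsymbol{x} \in \mathbb{R}^n$, $$\rho^{\mathrm{MCP}}(\boldsymbol{x}, \boldsymbol{\lambda}, \boldsymbol{\gamma}) = \sum_{i=1}^n \rho^{\mathrm{MCP}}_i(x_i,\lambda_i,\gamma_i), \qquad \rho^{\mathrm{MCP}}_i(x_i, \lambda_i, \gamma_i) = \lambda_i \int_{0}^{|x_i|} \left(1 - \frac{y}{\lambda_i \gamma_i}\right)_+ dy .$$ Then $\boldsymbol{x} \mapsto \rho^{\mathrm{MCP}}(\boldsymbol{x}, \boldsymbol{\lambda}, \boldsymbol{\gamma})$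 is a scale function (with univariate components $x_i \mapsto \rho^{\mathrm{MCP}}_i(x_i,\lambda_i,\gamma_i)$).
   Context: Notation: $[n] = \{1,\dots,n\}$ and $(x)_+ = \max\{0,x\}$ for $x \in \mathbb{R}$. Definition (scale function). A scale function is a function $\eta:\mathbb{R}^n \to \mathbb{R}_+$ of the form $\eta(\boldsymbol{x}) = \sum_{i=1}^n \eta_i(x_i)$, where each $\eta_i:\mathbb{R} \to \mathbb{R}_+ = [0,\infty)$ is a real-valued univariate function such that (i) $\eta_i(x) = 0$ if and only if $x = 0$; (ii) $\eta_i(x_1) \leq \eta_i(x_2)$ whenever $0 \leq x_1 \leq x_2$; (iii) $\eta_i(x_1) \geq \eta_i(x_2)$ whenever $x_1 \leq x_2 \leq 0$. *)

theory Defs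
  imports "HOL-Analysis.Analysis"
begin

definition pos_part :: "real \<Rightarrow> real" where
  "pos_part x = max 0 x"

definition scale_component :: "(real \<Rightarrow> real) \<Rightarrow> bool" where
  "scale_component h \<longleftrightarrow>
     (\<forall>x. h x \<ge> 0) \<and>
     (\<forall>x. h x = 0 \<longleftrightarrow> x = 0) \<and>
     (\<forall>x1 x2. 0 \<le> x1 \<and> x1 \<le> x2 \<longrightarrow> h x1 \<le> h x2) \<and>
     (\<forall>x1 x2. x1 \<le> x2 \<and> x2 \<le> 0 \<longrightarrow> h x1 \<ge> h x2)"

definition scale_function_with ::
    "(real ^ 'n \<Rightarrow> real) \<Rightarrow> ('n::finite \<Rightarrow> real \<Rightarrow> real) \<Rightarrow> bool" where
  "scale_function_with \<eta> h \<longleftrightarrow>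
     (\<forall>x. \<eta> x \<ge> 0) \<and>
     (\<forall>i. scale_component (h i)) \<and>
     (\<forall>x. \<eta> x = (\<Sum>i\<in>UNIV. h i (x $ i)))"

definition scale_function :: "(real ^ 'n::finite \<Rightarrow> real) \<Rightarrow> bool" where
  "scale_function \<eta> \<longleftrightarrow> (\<exists>h. scale_function_with \<eta> h)"

text \<open>For \<open>lam > 0, gam > 2\<close> (SCAD) and \<open>lam, gam > 0\<close> (MCP) the integrands below are continuous, so the
  Henstock-Kurzweil integral is the ordinary one and its default value for
  non-integrable functions plays no role.\<close>

definition scad1 :: "real \<Rightarrow> real \<Rightarrow> real \<Rightarrow> real" where
  "scad1 x lam gam =
     lam * integral {0..\<bar>x\<bar>} (\<lambda>y. min 1 (pos_part (gam - y / lam) / (gam - 1)))"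

definition scad :: "real ^ 'n::finite \<Rightarrow> real ^ 'n \<Rightarrow> real ^ 'n \<Rightarrow> real" where
  "scad x lam gam = (\<Sum>i\<in>UNIV. scad1 (x $ i) (lam $ i) (gam $ i))"

definition mcp1 :: "real \<Rightarrow> real \<Rightarrow> real \<Rightarrow> real" where
  "mcp1 x lam gam =
     lam * integral {0..\<bar>x\<bar>} (\<lambda>y. pos_part (1 - y / (lam * gam)))"

definition mcp :: "real ^ 'n::finite \<Rightarrow> real ^ 'n \<Rightarrow> real ^ 'n \<Rightarrow> real" where
  "mcp x lam gam = (\<Sum>i\<in>UNIV. mcp1 (x $ i) (lam $ i) (gam $ i))"

end

theory Submission
  imports Defs
begin

text \<open>Both penalties are, in each coordinate, a positive multiple of the primitive
  \<open>\<integral>\<^sub>0\<^bsup>\<bar>x\<bar>\<^esup> g\<close> of a continuous integrand \<open>g \<ge> 0\<close> with \<open>g 0 = 1 > 0\<close>. Nonnegativity of \<open>g\<close> makes the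
  primitive nonnegative and nondecreasing in \<open>\<bar>x\<bar>\<close>, which gives both monotonicity conditions at once.
  It vanishes only at \<open>x = 0\<close>, because a continuous nonnegative function with integral \<open>0\<close> over
  \<open>[0, \<bar>x\<bar>]\<close> is zero on that interval, in particular at \<open>0\<close>. The argument is
  \<open>scale_component_primitive\<close>; the two penalties differ only in \<open>g\<close>.\<close>

text \<open>Strict positivity of \<open>g\<close> is asked for only at the origin because the two integrands vanish
  from some point on, where their primitives become constant.\<close>

lemma scale_component_primitive:
  fixes g :: "real \<Rightarrow> real" and c :: real
  assumes c: "c > 0"
    and cont: "continuous_on {0..} g"
    and nonneg: "\<And>y. 0 \<le> y \<Longrightarrow> 0 \<le> g y"
    and pos: "g 0 > 0"
  shows "scale_component (\<lambda>x. c * integral {0..\<bar>x\<bar>} g)"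
proof -
  have cont_Icc: "continuous_on {0..b} g" for b
    by (rule continuous_on_subset[OF cont]) auto
  have int: "g integrable_on {0..b}" for b
    by (rule integrable_continuous_real[OF cont_Icc])
  have mono: "integral {0..a} g \<le> integral {0..b} g" if "a \<le> b" for a b
    by (rule integral_subset_le) (use that int nonneg in auto)
  have int_nonneg: "0 \<le> integral {0..b} g" for b
    by (rule integral_nonneg) (use int nonneg in auto)
  have int_zero: "integral {0..\<bar>x\<bar>} g = 0 \<longleftrightarrow> x = 0" for x
  proof
    assume zero: "integral {0..\<bar>x\<bar>} g = 0"
    show "x = 0"
    proof (rule ccontr)
      assume "x \<noteq> 0"
      then have "\<forall>y\<in>{0..\<bar>x\<bar>}. g y = 0"
        using integral_eq_0_iff[OF cont_Icc, of "\<bar>x\<bar>"] nonneg zero by auto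
      with pos show False by auto
    qed
  qed simp
  show ?thesis
    unfolding scale_component_def
    using c mono int_nonneg int_zero by (auto intro!: mult_left_mono)
qed

lemma scale_component_scad1:
  assumes "lam > 0" and "gam > 2"
  shows "scale_component (\<lambda>x. scad1 x lam gam)"
  unfolding scad1_def pos_part_def
  by (rule scale_component_primitive) (use assms in \<open>auto intro!: continuous_intros\<close>)

lemma scale_component_mcp1:
  assumes "lam > 0" and "gam > 0"
  shows "scale_component (\<lambda>x. mcp1 x lam gam)"
  unfolding mcp1_def pos_part_def
  by (rule scale_component_primitive) (use assms in \<open>auto intro!: continuous_intros\<close>)

lemma scale_function_with_sum:
  fixes h :: "'n::finite \<Rightarrow> real \<Rightarrow> real"
  assumes "\<And>i. scale_component (h i)"
  shows "scale_function_with (\<lambda>x. \<Sum>i\<in>UNIV. h i (x $ i)) h"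
  using assms by (auto simp: scale_function_with_def scale_component_def intro!: sum_nonneg)

theorem proposition1:
  shows "(\<forall>lam gam :: real ^ 'n::finite.
            (\<forall>i. lam $ i > 0) \<and> (\<forall>i. gam $ i > 2) \<longrightarrow>
            scale_function (\<lambda>x. scad x lam gam) \<and>
            scale_function_with (\<lambda>x. scad x lam gam) (\<lambda>i t. scad1 t (lam $ i) (gam $ i))) \<and>
         (\<forall>lam gam :: real ^ 'n.
            (\<forall>i. lam $ i > 0) \<and> (\<forall>i. gam $ i > 0) \<longrightarrow>
            scale_function (\<lambda>x. mcp x lam gam) \<and>
            scale_function_with (\<lambda>x. mcp x lam gam) (\<lambda>i t. mcp1 t (lam $ i) (gam $ i)))"
proof (intro conjI allI impI; elim conjE)
  fix lam gam :: "real ^ 'n"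
  assume "\<forall>i. lam $ i > 0" and "\<forall>i. gam $ i > 2"
  then show components: "scale_function_with (\<lambda>x. scad x lam gam) (\<lambda>i t. scad1 t (lam $ i) (gam $ i))"
    unfolding scad_def by (intro scale_function_with_sum scale_component_scad1) auto
  then show "scale_function (\<lambda>x. scad x lam gam)"
    unfolding scale_function_def by blast
next
  fix lam gam :: "real ^ 'n"
  assume "\<forall>i. lam $ i > 0" and "\<forall>i. gam $ i > 0"
  then show components: "scale_function_with (\<lambda>x. mcp x lam gam) (\<lambda>i t. mcp1 t (lam $ i) (gam $ i))"
    unfolding mcp_def by (intro scale_function_with_sum scale_component_mcp1) auto
  then show "scale_function (\<lambda>x. mcp x lam gam)"
    unfolding scale_function_def by blast
qed

end
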